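(* Let $q$ be a prime power and let $C_1$ and $C_2$ be two Hermitian LCD $[n,k]_{q^2}$ codes. Then there exists a unitary matrix $Q\in \mathbb{U}_{n}(q^2)$ such that $C_2=C_1Q$. Conversely, for any Hermitian LCD $[n,k]_{q^2}$ code $C$ and any unitary matrix $Q\in \mathbb{U}_{n}(q^2)$, $CQ$ is also a Hermitian LCD $[n,k]_{q^2}$ code.
   Context: $\mathbb{F}_{q^2}$ is the field with $q^2$ elements. A linear $[n,k]_{q^2}$ code is a $k$-dimensional subspace $C$ of $\mathbb{F}_{q^2}^n$ (row vectors). The Hermitian inner product is $\langle \mathbf{x},\mathbf{y}\rangle_{\rm H}=\sum_{i=1}^n x_iy_i^q$, and $C^{\perp_{\rm H}}=\{\mathbf{y}\in\mathbb{F}_{q^2}^n : \langle \mathbf{x},\mathbf{y}\rangle_{\rm H}=0 \text{ for all } \mathbf{x}\in C\}$. The code $C$ is Hermitian LCD if $C\cap C^{\perp_{\rm H}}=\{\mathbf{0}\}$. For an $n\times n$ matrix $Q$ over $\mathbb{F}_{q^2}$, $CQ=\{\mathbf{c}Q : \mathbf{c}\in C\}$. For $A=(a_{ij})$ over $\mathbb{F}_{q^2}$, $\overline{A}=(a_{ij}^q)$. The unitary group is $\mathbb{U}_n(q^2)=\{Q\in \mathrm{GL}_n(\mathbb{F}_{q^2}) : Q\overline{Q}^T=I_n\}$. *)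

theory Defs
  imports "HOL-Analysis.Analysis" "HOL-Number_Theory.Prime_Powers"
begin

text \<open>
  The field with \<open>q\<^sup>2\<close> elements is a finite field type \<open>'a\<close> with \<open>CARD('a) = q\<^sup>2\<close>;
  the parameter \<open>q\<close> is passed explicitly to the notions involving the conjugation \<open>x \<mapsto> x ^ q\<close>.
  The length of a code is \<open>n = CARD('n)\<close>. The prefix \<open>vec\<close> refers to the library's vector space
  structure on \<open>'a ^ 'n\<close> with scalar multiplication by elements of \<open>'a\<close>.
\<close>

definition linear_code :: "nat \<Rightarrow> ('a::{field,finite} ^ 'n) set \<Rightarrow> bool" where
  "linear_code k C \<longleftrightarrow> vec.subspace C \<and> vec.dim C = k"

definition herm_inner :: "nat \<Rightarrow> 'a::{field,finite} ^ 'n \<Rightarrow> 'a ^ 'n \<Rightarrow> 'a" where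
  "herm_inner q x y = (\<Sum>i\<in>UNIV. x $ i * (y $ i) ^ q)"

definition herm_dual :: "nat \<Rightarrow> ('a::{field,finite} ^ 'n) set \<Rightarrow> ('a ^ 'n) set" where
  "herm_dual q C = {y. \<forall>x\<in>C. herm_inner q x y = 0}"

definition herm_LCD :: "nat \<Rightarrow> ('a::{field,finite} ^ 'n) set \<Rightarrow> bool" where
  "herm_LCD q C \<longleftrightarrow> C \<inter> herm_dual q C = {0}"

definition code_mult :: "('a::{field,finite} ^ 'n) set \<Rightarrow> 'a ^ 'n ^ 'n \<Rightarrow> ('a ^ 'n) set" where
  "code_mult C Q = (\<lambda>c. c v* Q) ` C"

definition conj_matrix :: "nat \<Rightarrow> 'a::{field,finite} ^ 'n ^ 'm \<Rightarrow> 'a ^ 'n ^ 'm" where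
  "conj_matrix q A = map_matrix (\<lambda>a. a ^ q) A"

definition unitary_group :: "nat \<Rightarrow> ('a::{field,finite} ^ 'n ^ 'n) set" where
  "unitary_group q = {Q. invertible Q \<and> Q ** transpose (conj_matrix q Q) = mat 1}"

end

theory Submission
  imports Defs "HOL-Computational_Algebra.Polynomial"
begin

text \<open>
  A nondegenerate subspace has an orthonormal basis, and every orthonormal subset of it extends
  to one: a maximal orthonormal set spans, because the vectors orthogonal to it again form a
  nondegenerate subspace, which contains a vector of norm 1 unless it is zero. The norm-1 vector
  exists since the trace \<open>c \<mapsto> c + c ^ q\<close> is not identically zero and the norm
  \<open>b \<mapsto> b ^ (q + 1)\<close> is onto the fixed field of \<open>x \<mapsto> x ^ q\<close>. Extending orthonormal bases of
  \<open>C1\<close> and \<open>C2\<close> to the whole space, a bijection between the two bases that maps the first basis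
  to the second defines \<open>Q\<close>.
\<close>

section \<open>Auxiliary facts on finite fields, matrices and bijections\<close>

lemma card_power_eq_le:
  fixes c :: "'a :: idom"
  assumes "n > 0"
  shows "card {x. x ^ n = c} \<le> n"
proof -
  let ?p = "monom 1 n - [:c:]"
  have "coeff ?p n = 1"
    using assms by (cases n) simp_all
  then have "?p \<noteq> 0"
    by (metis coeff_0 zero_neq_one)
  moreover have "degree ?p \<le> n"
    by (intro degree_diff_le degree_monom_le) simp
  ultimately have "card {x. poly ?p x = 0} \<le> n"
    using card_poly_roots_bound le_trans by blast
  then show ?thesis
    by (simp add: poly_monom)
qed

text \<open>Multiplication by \<open>x\<close> permutes the nonzero elements, so it leaves their
  product unchanged; the product is then cancelled.\<close>

lemma finite_field_power_card_diff_1: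
  fixes x :: "'a :: {field,finite}"
  assumes "x \<noteq> 0"
  shows "x ^ (CARD('a) - 1) = 1"
proof -
  have "x ^ (CARD('a) - 1) * \<Prod>(UNIV - {0}) = (\<Prod>y\<in>UNIV-{0}. x * y)"
    by (simp add: prod.distrib)
  also have "\<dots> = \<Prod>(UNIV - {0})"
    by (rule prod.reindex_bij_witness[of _ "\<lambda>y. y / x" "\<lambda>y. x * y"]) (use assms in auto)
  finally show ?thesis
    by simp
qed

text \<open>Translation by 1 permutes the ring, so the sum of all elements absorbs
  \<open>CARD('a)\<close> copies of 1.\<close>

lemma of_nat_card_finite_ring: "of_nat (CARD('a)) = (0 :: 'a :: {ring_1,finite})"
proof -
  have "(\<Sum>x\<in>UNIV. x + 1 :: 'a) = (\<Sum>x\<in>UNIV. x)"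
    by (rule sum.reindex_bij_witness[of _ "\<lambda>y. y - 1" "\<lambda>y. y + 1"]) auto
  then show ?thesis
    by (simp add: sum.distrib)
qed

lemma row_matrix_mult: "(A ** B) $ i = A $ i v* B"
  by (simp add: vec_eq_iff matrix_matrix_mult_def vector_matrix_mult_def)

lemma linear_vector_matrix_mult:
  "Vector_Spaces.linear (*s) (*s) (\<lambda>x :: 'a :: field ^ 'n. x v* Q)"
proof -
  have "(\<lambda>x. x v* Q) = (*v) (transpose Q)"
    by (simp add: fun_eq_iff)
  then show ?thesis
    by (simp only: matrix_vector_mul_linear_gen)
qed

text \<open>Bijections between the subsets and between their complements are glued. This later
  matches bases of the whole space so that a basis of one code goes to a basis of the other.\<close>

lemma finite_bij_extend:
  assumes "finite A" "finite B" "card A = card B"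
    and "A' \<subseteq> A" "B' \<subseteq> B" "card A' = card B'"
  obtains f where "bij_betw f A B" "f ` A' = B'"
proof -
  have fin: "finite A'" "finite B'"
    using assms finite_subset by blast+
  obtain g where g: "bij_betw g A' B'"
    using finite_same_card_bij[OF fin assms(6)] by blast
  have "card (A - A') = card (B - B')"
    using assms fin by (simp add: card_Diff_subset)
  then obtain h where h: "bij_betw h (A - A') (B - B')"
    using finite_same_card_bij[of "A - A'" "B - B'"] assms by blast
  let ?f = "\<lambda>x. if x \<in> A' then g x else h x"
  have "bij_betw ?f (A' \<union> (A - A')) (B' \<union> (B - B'))"
    using g h by (rule bij_betw_disjoint_Un) auto
  then have "bij_betw ?f A B"
    using assms by (simp add: Un_absorb1)
  moreover have "?f ` A' = B'"
    using g by (auto simp: bij_betw_def)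
  ultimately show thesis
    by (rule that)
qed

section \<open>Conjugation, norm and trace over the field with \<open>q\<^sup>2\<close>
  elements\<close>

locale hermitian_field =
  fixes q :: nat and F :: "'a :: {field,finite} itself"
  assumes primepow_q: "primepow q" and card_field: "CARD('a) = q\<^sup>2"
begin

abbreviation herm :: "'a ^ 'n \<Rightarrow> 'a ^ 'n \<Rightarrow> 'a" where
  "herm \<equiv> herm_inner q"

abbreviation adj :: "'a ^ 'n ^ 'm \<Rightarrow> 'a ^ 'm ^ 'n" where
  "adj A \<equiv> transpose (conj_matrix q A)"

lemma q_gt_1: "q > 1"
  using primepow_q primepow_gt_Suc_0 by auto

lemma prime_CHAR: "prime CHAR('a)"
  using prime_CHAR_semidom[where ?'a = 'a] finite_imp_CHAR_pos[where ?'a = 'a] by simp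

text \<open>The characteristic divides the number of elements, a power of the prime below
  \<open>q\<close>, and so equals that prime. Hence conjugation is an iterate of the Frobenius map,
  which makes it additive.\<close>

lemma q_eq_CHAR_power: "\<exists>m. q = CHAR('a) ^ m"
proof -
  obtain p m where p: "prime p" "q = p ^ m"
    using primepow_q by (auto simp: primepow_def)
  have "CHAR('a) dvd p ^ (m * 2)"
    using of_nat_card_finite_ring[where 'a = 'a] card_field p(2)
    by (metis of_nat_eq_0_iff_char_dvd power_mult)
  then have "CHAR('a) = p"
    using prime_CHAR p(1) prime_dvd_power primes_dvd_imp_eq by blast
  then show ?thesis
    using p by blast
qed

lemma power_q_add: "(x + y :: 'a) ^ q = x ^ q + y ^ q"
  using q_eq_CHAR_power freshmans_dream' prime_CHAR by blast

lemma power_q_sum: "(\<Sum>i\<in>I. f i :: 'a) ^ q = (\<Sum>i\<in>I. f i ^ q)"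
  using q_eq_CHAR_power freshmans_dream_sum' prime_CHAR by blast

lemma power_q_power_q [simp]: "((x :: 'a) ^ q) ^ q = x"
proof (cases "x = 0")
  case False
  have "x ^ q\<^sup>2 = x ^ Suc (q\<^sup>2 - 1)"
    using q_gt_1 by simp
  also have "\<dots> = x"
    using finite_field_power_card_diff_1[OF False] by (simp only: card_field power_Suc) simp
  finally show ?thesis
    by (simp add: power2_eq_square power_mult)
qed (use q_gt_1 in simp)

text \<open>A counting argument: the norm sends the \<open>q\<^sup>2 - 1\<close> nonzero elements
  into the roots of \<open>y ^ (q - 1) = 1\<close>, of which there are at most \<open>q - 1\<close>.
  Its fibres have at most \<open>q + 1\<close> elements, so its image has at least
  \<open>q - 1\<close> and is the whole set of roots.\<close>

lemma norm_surj:
  assumes "(a :: 'a) ^ q = a"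
  shows "\<exists>b. b * b ^ q = a"
proof (cases "a = 0")
  case True
  then show ?thesis by auto
next
  case False
  let ?U = "UNIV - {0 :: 'a}" and ?N = "\<lambda>b :: 'a. b * b ^ q"
  have "?N ` ?U \<subseteq> {y. y ^ (q - 1) = 1}"
  proof safe
    fix b :: 'a assume b: "b \<noteq> 0"
    have "?N b ^ q = ?N b"
      by (simp add: power_mult_distrib mult.commute)
    then have "?N b * ?N b ^ (q - 1) = ?N b * 1"
      using q_gt_1 by (simp flip: power_Suc)
    then show "?N b ^ (q - 1) = 1"
      using b by simp
  qed
  moreover have "card {y :: 'a. y ^ (q - 1) = 1} \<le> card (?N ` ?U)"
  proof -
    have "(q + 1) * (q - 1) = card ?U"
      using q_gt_1 card_field by (simp add: algebra_simps power2_eq_square)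
    also have "\<dots> \<le> (\<Sum>y\<in>?N ` ?U. card {b \<in> ?U. ?N b = y})"
      using sum.image_gen[of ?U "\<lambda>_. 1 :: nat" ?N] by simp
    also have "\<dots> \<le> (\<Sum>y\<in>?N ` ?U. q + 1)"
    proof (rule sum_mono)
      fix y
      have "card {b \<in> ?U. ?N b = y} \<le> card {b. b ^ (q + 1) = y}"
        by (intro card_mono) auto
      also have "\<dots> \<le> q + 1"
        by (rule card_power_eq_le) simp
      finally show "card {b \<in> ?U. ?N b = y} \<le> q + 1" .
    qed
    finally have "(q + 1) * (q - 1) \<le> (q + 1) * card (?N ` ?U)"
      by (simp add: mult.commute)
    then have "q - 1 \<le> card (?N ` ?U)"
      by (metis mult_le_cancel1 add_gr_0 zero_less_one)
    then show ?thesis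
      using card_power_eq_le[of "q - 1" "1 :: 'a"] q_gt_1 by linarith
  qed
  ultimately have "?N ` ?U = {y. y ^ (q - 1) = 1}"
    by (intro card_seteq) auto
  moreover have "a ^ (q - 1) = 1"
  proof -
    have "a * a ^ (q - 1) = a * 1"
      using q_gt_1 assms by (simp flip: power_Suc)
    then show ?thesis
      using False by simp
  qed
  ultimately show ?thesis
    by (metis (mono_tags, lifting) imageE mem_Collect_eq)
qed

text \<open>Otherwise conjugation would be the identity, and all \<open>q\<^sup>2 - 1\<close>
  nonzero elements would be roots of \<open>c ^ (q - 1) = 1\<close>.\<close>

lemma trace_nonzero: "\<exists>c :: 'a. c + c ^ q \<noteq> 0"
proof (rule ccontr)
  assume "\<not> ?thesis"
  then have all: "c + c ^ q = 0" for c :: 'a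
    by blast
  \<comment> \<open>The vanishing trace of 1 gives -1 = 1, which turns \<open>c ^ q = - c\<close>
    into \<open>c ^ q = c\<close>.\<close>
  have "c ^ q = c" for c :: 'a
    using all[of c] all[of 1] by (metis add_eq_0_iff mult_minus1 mult_1 power_one)
  then have "c ^ (q - 1) = 1" if "c \<noteq> 0" for c :: 'a
    using that q_gt_1 power_Suc[of c "q - 1"] by simp
  then have "UNIV - {0 :: 'a} \<subseteq> {c. c ^ (q - 1) = 1}"
    by auto
  then have "card (UNIV - {0 :: 'a}) \<le> card {c :: 'a. c ^ (q - 1) = 1}"
    by (intro card_mono) auto
  also have "\<dots> \<le> q - 1"
    using q_gt_1 by (intro card_power_eq_le) simp
  finally have "q\<^sup>2 \<le> q"
    using q_gt_1 card_field by simp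
  then show False
    using q_gt_1 by (simp add: power2_eq_square)
qed

section \<open>The Hermitian form and its nondegenerate subspaces\<close>

lemma herm_add_left: "herm (x + y) z = herm x z + herm y z"
  by (simp add: herm_inner_def distrib_right sum.distrib)

lemma herm_scale_left: "herm (c *s x) y = c * herm x y"
  by (simp add: herm_inner_def sum_distrib_left mult.assoc)

lemma herm_diff_left: "herm (x - y) z = herm x z - herm y z"
  by (simp add: herm_inner_def left_diff_distrib sum_subtractf)

lemma herm_zero_left [simp]: "herm 0 x = 0"
  by (simp add: herm_inner_def)

lemma herm_sum_left: "herm (\<Sum>i\<in>I. f i) x = (\<Sum>i\<in>I. herm (f i) x)"
  by (induction I rule: infinite_finite_induct) (auto simp: herm_add_left)

lemma herm_add_right: "herm x (y + z) = herm x y + herm x z"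
  by (simp add: herm_inner_def power_q_add distrib_left sum.distrib)

lemma herm_scale_right: "herm x (c *s y) = c ^ q * herm x y"
  by (simp add: herm_inner_def sum_distrib_left power_mult_distrib ac_simps)

lemma herm_conj: "herm x y ^ q = herm y x"
  by (simp add: herm_inner_def power_q_sum power_mult_distrib ac_simps)

lemma herm_eq_0_commute: "herm x y = 0 \<longleftrightarrow> herm y x = 0"
proof -
  have "herm x y = 0 \<Longrightarrow> herm y x = 0" for x y :: "'a ^ 'n"
    using herm_conj[of x y] q_gt_1 by (metis not_one_less_zero zero_power bot_nat_0.not_eq_extremum)
  then show ?thesis by blast
qed

text \<open>Expresses the LCD property as nondegeneracy of the form restricted to \<open>W\<close>,
  the shape used in all later arguments.\<close>

lemma herm_LCD_iff:
  "vec.subspace W \<Longrightarrow> herm_LCD q W \<longleftrightarrow> (\<forall>x\<in>W. x \<noteq> 0 \<longrightarrow> (\<exists>y\<in>W. herm y x \<noteq> 0))"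
  using vec.subspace_0 herm_eq_0_commute[of _ 0]
  by (fastforce simp: herm_LCD_def herm_dual_def)

lemma herm_axis: "herm (axis i 1) x = (x $ i) ^ q"
  by (simp add: herm_inner_def axis_def if_distrib if_distribR cong: if_cong)

text \<open>Allows an orthonormal basis of a code to be extended inside the whole space.\<close>

lemma herm_LCD_UNIV: "herm_LCD q (UNIV :: ('a ^ 'n) set)"
proof -
  have "\<exists>y. herm y x \<noteq> 0" if x: "x \<noteq> 0" for x :: "'a ^ 'n"
  proof -
    obtain i where "x $ i \<noteq> 0"
      using x by (auto simp: vec_eq_iff)
    then show ?thesis
      by (intro exI[of _ "axis i 1"]) (simp add: herm_axis)
  qed
  then show ?thesis
    by (simp add: herm_LCD_iff)
qed

lemma exists_unit_vector:
  assumes W: "vec.subspace W" "herm_LCD q W" and x: "x \<in> W" "x \<noteq> 0"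
  shows "\<exists>v\<in>W. herm v v = 1"
proof -
  have "\<exists>v\<in>W. herm v v \<noteq> 0"
  proof (rule ccontr)
    assume "\<not> ?thesis"
    then have iso: "herm v v = 0" if "v \<in> W" for v
      using that by blast
    obtain y where y: "y \<in> W" "herm y x \<noteq> 0"
      using W x herm_LCD_iff by blast
    obtain c :: 'a where c: "c + c ^ q \<noteq> 0"
      using trace_nonzero by blast
    \<comment> \<open>The scalar is chosen so that \<open>herm u x = c\<close>. If \<open>u\<close>,
      \<open>x\<close> and \<open>u + x\<close> were all isotropic, expanding the form at
      \<open>u + x\<close> would leave the trace of \<open>c\<close>, which is nonzero.\<close>
    define u where "u = (c / herm y x) *s y"
    have u: "u \<in> W" "herm u x = c"
      using y W by (auto simp: u_def herm_scale_left vec.subspace_scale)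
    have "herm (u + x) (u + x) = herm u u + herm x x + (herm u x + herm u x ^ q)"
      by (simp add: herm_add_left herm_add_right herm_conj)
    then show False
      using iso u x c W vec.subspace_add by fastforce
  qed
  then obtain v where v: "v \<in> W" "herm v v \<noteq> 0"
    by blast
  \<comment> \<open>By Hermitian symmetry \<open>herm v v\<close> is fixed by conjugation, hence so
    is its inverse, which is therefore a norm.\<close>
  obtain b where b: "b * b ^ q = inverse (herm v v)"
    using norm_surj[of "inverse (herm v v)"] herm_conj[of v v] by (auto simp: power_inverse)
  have "herm (b *s v) (b *s v) = b * b ^ q * herm v v"
    by (simp add: herm_scale_left herm_scale_right)
  then have "herm (b *s v) (b *s v) = 1"
    using v b by simp
  then show ?thesis
    using v W vec.subspace_scale by blast
qed

section \<open>Orthonormal sets and their extension to bases\<close>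

definition orthonormal :: "('a ^ 'n) set \<Rightarrow> bool" where
  "orthonormal S \<longleftrightarrow> (\<forall>u\<in>S. \<forall>v\<in>S. herm u v = (if u = v then 1 else 0))"

lemma herm_sum_orthonormal:
  assumes "orthonormal S" "s \<in> S"
  shows "herm (\<Sum>v\<in>S. c v *s v) s = c s"
proof -
  have "herm (\<Sum>v\<in>S. c v *s v) s = (\<Sum>v\<in>S. if v = s then c v else 0)"
    using assms unfolding herm_sum_left
    by (intro sum.cong) (auto simp: herm_scale_left orthonormal_def)
  then show ?thesis
    using assms by simp
qed

lemma orthonormal_independent: "orthonormal S \<Longrightarrow> vec.independent S"
proof (rule vec.independent_if_scalars_zero)
  fix c x assume "orthonormal S" "(\<Sum>v\<in>S. c v *s v) = 0" "x \<in> S"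
  then show "c x = 0"
    using herm_sum_orthonormal[of S x c] by simp
qed simp

lemma orthonormal_extend:
  assumes W: "vec.subspace W" "herm_LCD q W" and S: "S \<subseteq> W" "orthonormal S"
  obtains T where "S \<subseteq> T" "T \<subseteq> W" "orthonormal T" "vec.span T = W"
proof -
  let ?A = "{T. T \<subseteq> W \<and> orthonormal T}"
  obtain T where T: "T \<subseteq> W" "orthonormal T" "S \<subseteq> T"
    and max: "\<And>T'. T' \<in> ?A \<Longrightarrow> T \<subseteq> T' \<Longrightarrow> T = T'"
    using finite_has_maximal2[of ?A S] S by auto
  \<comment> \<open>\<open>P\<close> is the orthogonal projection onto the span of \<open>T\<close>,
    and \<open>W'\<close> is the orthogonal complement of \<open>T\<close> inside
    \<open>W\<close>.\<close>
  define P where "P x = (\<Sum>s\<in>T. herm x s *s s)" for x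
  define W' where "W' = {x \<in> W. \<forall>s\<in>T. herm x s = 0}"
  have P: "P x \<in> vec.span T" for x
    unfolding P_def by (intro vec.span_sum vec.span_scale vec.span_base)
  have span: "vec.span T \<subseteq> W"
    using T W by (simp add: vec.span_minimal)
  have residual: "x - P x \<in> W'" if "x \<in> W" for x
  proof -
    have "x - P x \<in> W"
      using that P span W vec.subspace_diff by blast
    then show ?thesis
      using T(2) by (simp add: W'_def P_def herm_diff_left herm_sum_orthonormal)
  qed
  have W': "vec.subspace W'"
    using W unfolding W'_def vec.subspace_def by (auto simp: herm_add_left herm_scale_left)
  have "herm_LCD q W'"
    unfolding herm_LCD_iff[OF W']
  proof (intro ballI impI)
    fix x assume x: "x \<in> W'" "x \<noteq> 0"
    then obtain y where y: "y \<in> W" "herm y x \<noteq> 0"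
      using W herm_LCD_iff[OF W(1)] unfolding W'_def by blast
    \<comment> \<open>A witness \<open>y\<close> in \<open>W\<close> may lie outside
      \<open>W'\<close>. Since \<open>x\<close> is orthogonal to \<open>T\<close>, removing the
      projection of \<open>y\<close> does not change its product with \<open>x\<close>.\<close>
    have "herm (P y) x = 0"
      using x herm_eq_0_commute unfolding P_def herm_sum_left
      by (fastforce simp: herm_scale_left W'_def intro: sum.neutral)
    then have "herm (y - P y) x \<noteq> 0"
      using y by (simp add: herm_diff_left)
    then show "\<exists>y\<in>W'. herm y x \<noteq> 0"
      using residual y by blast
  qed
  have "W' = {0}"
  proof (rule ccontr)
    assume "W' \<noteq> {0}"
    then obtain x where "x \<in> W'" "x \<noteq> 0"
      using vec.subspace_0[OF W'] by blast
    then obtain v where v: "v \<in> W'" "herm v v = 1"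
      using exists_unit_vector W' \<open>herm_LCD q W'\<close> by blast
    \<comment> \<open>A member of \<open>T\<close> lying in \<open>W'\<close> would be orthogonal to
      itself, whereas \<open>v\<close> has norm 1. So \<open>insert v T\<close> contradicts
      maximality.\<close>
    have "v \<notin> T"
      using v by (auto simp: W'_def)
    moreover have "insert v T \<in> ?A"
      using v T \<open>v \<notin> T\<close> herm_eq_0_commute[of _ v] by (auto simp: W'_def orthonormal_def)
    ultimately show False
      using max by blast
  qed
  then have "x = P x" if "x \<in> W" for x
    using residual[OF that] by simp
  then have "W \<subseteq> vec.span T"
    using P by (metis subsetI)
  then show thesis
    using that T span by blast
qed

section \<open>Adjoints and unitary matrices\<close>

lemma conj_matrix_mult: "conj_matrix q (A ** B) = conj_matrix q A ** conj_matrix q (B :: 'a ^ 'm ^ 'l)"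
  by (simp add: conj_matrix_def map_matrix_def matrix_matrix_mult_def vec_eq_iff power_q_sum
      power_mult_distrib)

lemma adj_mult: "adj (A ** B) = adj B ** adj A"
  by (simp add: conj_matrix_mult matrix_transpose_mul)

lemma adj_adj [simp]: "adj (adj A) = A"
  by (simp add: conj_matrix_def map_matrix_def transpose_def vec_eq_iff)

lemma unitary_group_iff: "Q \<in> unitary_group q \<longleftrightarrow> Q ** adj Q = mat 1"
  using invertible_right_inverse by (auto simp: unitary_group_def)

text \<open>Since \<open>adj P\<close> is the inverse of \<open>P\<close>, this product is the
  change of basis from the rows of \<open>P\<close> to the rows of \<open>R\<close>.\<close>

lemma unitary_group_adj_mult:
  assumes "P \<in> unitary_group q" "R \<in> unitary_group q"
  shows "adj P ** R \<in> unitary_group q"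
proof -
  have "(adj P ** R) ** adj (adj P ** R) = adj P ** (R ** adj R) ** P"
    by (simp add: adj_mult matrix_mul_assoc)
  also have "\<dots> = mat 1"
    using assms by (simp add: unitary_group_iff matrix_left_right_inverse)
  finally show ?thesis
    by (simp add: unitary_group_iff)
qed

text \<open>The product with the adjoint is the Gram matrix of the rows. Injectivity ensures that
  distinct indices give distinct vectors, so the off-diagonal entries vanish.\<close>

lemma orthonormal_rows_unitary:
  assumes "orthonormal (range g)" "inj g"
  shows "(\<chi> i. g i) \<in> unitary_group q"
proof -
  have "((\<chi> i. g i) ** adj (\<chi> i. g i)) $ i $ j = herm (g i) (g j)" for i j
    by (simp add: matrix_matrix_mult_def herm_inner_def transpose_def conj_matrix_def
        map_matrix_def)
  then show ?thesis
    using assms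
    by (simp add: unitary_group_iff vec_eq_iff[of "_ ** _"] vec_eq_iff[of "(_ ** _) $ _"] mat_def
        orthonormal_def inj_eq)
qed

text \<open>After exchanging the sums, the conjugation in the second argument undoes the one in
  \<open>adj Q\<close>, because conjugation is an involution.\<close>

lemma herm_vector_matrix_mult_left: "herm (x v* Q) y = herm x (y v* adj Q)"
proof -
  have "herm (x v* Q) y = (\<Sum>j\<in>UNIV. \<Sum>i\<in>UNIV. x $ i * Q $ i $ j * (y $ j) ^ q)"
    by (simp add: herm_inner_def vector_matrix_mult_def sum_distrib_right)
  also have "\<dots> = (\<Sum>i\<in>UNIV. \<Sum>j\<in>UNIV. x $ i * Q $ i $ j * (y $ j) ^ q)"
    by (rule sum.swap)
  also have "\<dots> = herm x (y v* adj Q)"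
    by (simp add: herm_inner_def vector_matrix_mult_def transpose_def conj_matrix_def
        map_matrix_def power_q_sum power_mult_distrib sum_distrib_left ac_simps)
  finally show ?thesis .
qed

lemma herm_unitary:
  assumes "Q \<in> unitary_group q"
  shows "herm (x v* Q) (y v* Q) = herm x y"
  using assms
  by (simp add: herm_vector_matrix_mult_left vector_matrix_mul_assoc unitary_group_iff
      del: vector_transpose_matrix)

section \<open>The two directions of the theorem\<close>

lemma unitary_transitive:
  fixes C1 C2 :: "('a ^ 'n) set"
  assumes C1: "linear_code k C1" "herm_LCD q C1" and C2: "linear_code k C2" "herm_LCD q C2"
  shows "\<exists>Q \<in> unitary_group q. C2 = code_mult C1 Q"
proof -
  have bases: "\<exists>S T. card S = k \<and> vec.span S = C \<and> S \<subseteq> T \<and> orthonormal T \<and> card T = CARD('n)"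
    if C: "linear_code k C" "herm_LCD q C" for C :: "('a ^ 'n) set"
  proof -
    have "vec.subspace C" "orthonormal ({} :: ('a ^ 'n) set)"
      using C by (simp_all add: linear_code_def orthonormal_def)
    \<comment> \<open>Extending the empty set inside \<open>C\<close> yields an orthonormal basis of
      \<open>C\<close>; extending that one inside the whole space yields \<open>T\<close>.\<close>
    then obtain S where S: "orthonormal S" "vec.span S = C"
      by (rule orthonormal_extend[OF _ C(2) empty_subsetI])
    obtain T where T: "S \<subseteq> T" "orthonormal T" "vec.span T = UNIV"
      by (rule orthonormal_extend[OF vec.subspace_UNIV herm_LCD_UNIV subset_UNIV S(1)])
    have "card S = k"
      using S C vec.dim_span_eq_card_independent orthonormal_independent
      unfolding linear_code_def by metis
    moreover have "card T = CARD('n)"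
      using T vec.dim_span_eq_card_independent[OF orthonormal_independent[OF T(2)]]
      by (simp add: card_cart_basis)
    ultimately show ?thesis
      using S T by blast
  qed
  obtain S1 T1 where 1: "card S1 = k" "vec.span S1 = C1" "S1 \<subseteq> T1" "orthonormal T1"
      "card T1 = CARD('n)"
    using bases[OF C1] by blast
  obtain S2 T2 where 2: "card S2 = k" "vec.span S2 = C2" "S2 \<subseteq> T2" "orthonormal T2"
      "card T2 = CARD('n)"
    using bases[OF C2] by blast
  obtain f where f: "bij_betw f T1 T2" "f ` S1 = S2"
    by (rule finite_bij_extend[of T1 T2 S1 S2]) (use 1 2 in auto)
  obtain g :: "'n \<Rightarrow> 'a ^ 'n" where g: "bij_betw g UNIV T1"
    using finite_same_card_bij[of "UNIV :: 'n set" T1] 1 by auto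
  have fg: "bij_betw (f \<circ> g) UNIV T2"
    using g f bij_betw_trans by blast
  \<comment> \<open>The rows of \<open>P\<close> list \<open>T1\<close> in the order given by
    \<open>g\<close>, and the rows of \<open>R\<close> list their images under \<open>f\<close>.
    Comparing rows in \<open>P ** Q = R\<close> shows that \<open>Q\<close> acts on
    \<open>T1\<close> as \<open>f\<close>.\<close>
  define P :: "'a ^ 'n ^ 'n" where "P = (\<chi> i. g i)"
  define R :: "'a ^ 'n ^ 'n" where "R = (\<chi> i. (f \<circ> g) i)"
  have P: "P \<in> unitary_group q"
    unfolding P_def using g 1 by (intro orthonormal_rows_unitary) (auto simp: bij_betw_def)
  have R: "R \<in> unitary_group q"
    unfolding R_def using fg 2
    by (intro orthonormal_rows_unitary) (auto simp: bij_betw_def simp del: o_apply)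
  define Q where "Q = adj P ** R"
  have "P ** Q = R"
    using P by (simp add: Q_def matrix_mul_assoc unitary_group_iff)
  then have "g i v* Q = f (g i)" for i
    using row_matrix_mult[of P Q i] by (simp add: P_def R_def)
  then have "s v* Q = f s" if "s \<in> T1" for s
    using that g by (metis bij_betw_imp_surj_on imageE)
  \<comment> \<open>As \<open>f\<close> carries \<open>S1\<close> to \<open>S2\<close>, linearity
    carries the span \<open>C1\<close> to the span \<open>C2\<close>.\<close>
  then have "(\<lambda>s. s v* Q) ` S1 = S2"
    using 1 f by (metis (no_types, lifting) image_cong subsetD)
  then have "code_mult C1 Q = C2"
    using 1 2 linear_vector_matrix_mult vec.linear_span_image
    unfolding code_mult_def by metis
  then show ?thesis
    using P R unitary_group_adj_mult unfolding Q_def by blast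
qed

text \<open>\<open>adj Q\<close> undoes \<open>Q\<close>, so the action is injective and keeps the
  dimension; it also preserves the form, so nondegeneracy carries over to the image.\<close>

lemma code_mult_unitary:
  fixes C :: "('a ^ 'n) set"
  assumes C: "linear_code k C" "herm_LCD q C" and Q: "Q \<in> unitary_group q"
  shows "linear_code k (code_mult C Q)" "herm_LCD q (code_mult C Q)"
proof -
  have "x v* Q v* adj Q = x" for x
    using Q by (simp add: vector_matrix_mul_assoc unitary_group_iff del: vector_transpose_matrix)
  then have inj: "inj (\<lambda>x. x v* Q)"
    by (metis injI)
  have sub: "vec.subspace C"
    using C by (simp add: linear_code_def)
  have sub': "vec.subspace (code_mult C Q)"
    unfolding code_mult_def using linear_vector_matrix_mult sub by (rule vec.linear_subspace_image)
  have "vec.dim (code_mult C Q) = vec.dim C"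
    unfolding code_mult_def using linear_vector_matrix_mult inj_on_subset[OF inj subset_UNIV]
    by (rule vec.dim_image_eq)
  then show "linear_code k (code_mult C Q)"
    using sub' C by (simp add: linear_code_def)
  have "\<exists>y\<in>C. herm y x \<noteq> 0" if "x \<in> C" "x v* Q \<noteq> 0" for x
    using that C(2) herm_LCD_iff[OF sub] vector_matrix_mult_0 by metis
  then show "herm_LCD q (code_mult C Q)"
    unfolding herm_LCD_iff[OF sub'] using Q by (auto simp: code_mult_def herm_unitary)
qed

end

theorem theorem3p2:
  fixes q k :: nat
  assumes "primepow q"
    and "CARD('a::{field,finite}) = q\<^sup>2"
  shows "(\<forall>C1 C2 :: ('a ^ 'n) set.
            linear_code k C1 \<and> herm_LCD q C1 \<and> linear_code k C2 \<and> herm_LCD q C2 \<longrightarrow>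
            (\<exists>Q \<in> unitary_group q. C2 = code_mult C1 Q)) \<and>
         (\<forall>(C :: ('a ^ 'n) set) (Q :: 'a ^ 'n ^ 'n).
            linear_code k C \<and> herm_LCD q C \<and> Q \<in> unitary_group q \<longrightarrow>
            linear_code k (code_mult C Q) \<and> herm_LCD q (code_mult C Q))"
proof -
  interpret hermitian_field q "TYPE('a)"
    by unfold_locales (fact assms)+
  show ?thesis
    by (intro conjI allI impI; elim conjE) (rule unitary_transitive code_mult_unitary; assumption)+
qed

end
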